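(* Let $C_n$ denote the cycle graph with $n>4$ vertices and adjacency matrix $A$, let $1\le i<j\le n$ and $0<\alpha<\frac1{\rho(A)}$. Then \[ K_{C_n}(\alpha)_{i,j}=\frac{\alpha^{k}d_{n-k-1}(\alpha)+\alpha^{n-k}d_{k-1}(\alpha)}{d_{n-1}(\alpha)-2\alpha^n-2\alpha^2d_{n-2}(\alpha)}-\mathbf 1_{ij}, \] where $k=\min(j-i,\,n-j+i)$ and $\mathbf 1_{ij}$ is the Kronecker delta, equal to $1$ if $i=j$ and $0$ otherwise.
   Context: For a simple graph $G$ with adjacency matrix $A$, spectral radius $\rho(A)$, and $0<\alpha<1/\rho(A)$, the Katz matrix is $K_G(\alpha)=\sum_{t=1}^\infty \alpha^tA^t=(I-\alpha A)^{-1}-I$, and the Katz similarity index between vertices $i$ and $j$ is the entry $K_G(\alpha)_{i,j}$. $C_n$ is the cycle graph on vertices $1,\dots,n$ with edges $\{i,i+1\}$ for $1\le i<n$ and $\{n,1\}$. For integers $i\ge0$, $d_i(\alpha)=\sum_{m=0}^{\lfloor i/2\rfloor}(-1)^m\binom{i-m}{m}\alpha^{2m}$. *)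

theory Defs
  imports "Jordan_Normal_Form.Spectral_Radius"
begin

text \<open>A simple graph on the vertices 1, ..., n is given by its set E of two-element edges.
  Matrices are indexed from 0, so vertex v corresponds to row and column v - 1.\<close>

definition adj_mat :: "nat \<Rightarrow> nat set set \<Rightarrow> real mat" where
  "adj_mat n E = mat n n (\<lambda>(r, c). if {r + 1, c + 1} \<in> E then 1 else 0)"

definition graph_spectral_radius :: "nat \<Rightarrow> nat set set \<Rightarrow> real" where
  "graph_spectral_radius n E = spectral_radius (map_mat complex_of_real (adj_mat n E))"

text \<open>The series starts at exponent 1, hence the shift by Suc; it is summed entrywise.\<close>

definition katz_matrix :: "nat \<Rightarrow> nat set set \<Rightarrow> real \<Rightarrow> real mat" where
  "katz_matrix n E \<alpha> =
     mat n n (\<lambda>(r, c). \<Sum>t. (\<alpha> ^ Suc t \<cdot>\<^sub>m (adj_mat n E ^\<^sub>m Suc t)) $$ (r, c))"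

definition katz_index :: "nat \<Rightarrow> nat set set \<Rightarrow> real \<Rightarrow> nat \<Rightarrow> nat \<Rightarrow> real" where
  "katz_index n E \<alpha> i j = katz_matrix n E \<alpha> $$ (i - 1, j - 1)"

definition cycle_edges :: "nat \<Rightarrow> nat set set" where
  "cycle_edges n = {{i, i + 1} | i. 1 \<le> i \<and> i < n} \<union> {{n, 1}}"

definition d :: "nat \<Rightarrow> real \<Rightarrow> real" where
  "d i \<alpha> = (\<Sum>m = 0..i div 2. (-1) ^ m * real ((i - m) choose m) * \<alpha> ^ (2 * m))"

end

theory Submission imports Defs begin

text \<open>The all-ones vector is an eigenvector of \<open>C\<^sub>n\<close> with eigenvalue 2, so \<open>\<alpha> < 1/2\<close>.
  For a fixed row the function \<open>c \<mapsto> \<Sum>t. \<alpha>\<^sup>t (A\<^sup>t)\<^sub>r\<^sub>c\<close> then converges and satisfies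
  \<open>x - \<alpha> A x = \<delta>\<^sub>r\<close>. Up to the factor \<open>D\<close> (the denominator), the claimed closed form satisfies
  the same system, because \<open>d\<^sub>i\<^sub>+\<^sub>2 = d\<^sub>i\<^sub>+\<^sub>1 - \<alpha>\<^sup>2 d\<^sub>i\<close>; the system has at most one solution
  since \<open>\<alpha> A\<close> contracts the maximum norm. If \<open>D\<close> were 0, uniqueness would make the closed form
  vanish, contradicting \<open>d\<^sub>n\<^sub>-\<^sub>1 > 0\<close>.\<close>

section \<open>Neighbours on the cycle and its adjacency matrix\<close>

definition cyc_prev :: "nat \<Rightarrow> nat \<Rightarrow> nat" where
  "cyc_prev n c = (if c = 0 then n - 1 else c - 1)"

definition cyc_next :: "nat \<Rightarrow> nat \<Rightarrow> nat" where
  "cyc_next n c = (if c = n - 1 then 0 else c + 1)"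

lemma cyc_prev_less: "c < n \<Longrightarrow> cyc_prev n c < n"
  and cyc_next_less: "c < n \<Longrightarrow> cyc_next n c < n"
  by (auto simp: cyc_prev_def cyc_next_def)

lemma cyc_prev_neq_next: "2 < n \<Longrightarrow> cyc_prev n c \<noteq> cyc_next n c"
  by (auto simp: cyc_prev_def cyc_next_def)

lemma mem_cycle_edges_iff:
  assumes "m < n" "c < n"
  shows "{m + 1, c + 1} \<in> cycle_edges n \<longleftrightarrow> m = cyc_prev n c \<or> m = cyc_next n c"
proof
  assume "{m + 1, c + 1} \<in> cycle_edges n"
  then show "m = cyc_prev n c \<or> m = cyc_next n c"
    using assms by (auto simp: cycle_edges_def cyc_prev_def cyc_next_def doubleton_eq_iff)
next
  assume "m = cyc_prev n c \<or> m = cyc_next n c"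
  then consider "c = m + 1" | "m = c + 1" | "c = 0" "m = n - 1" | "m = 0" "c = n - 1"
    by (auto simp: cyc_prev_def cyc_next_def split: if_splits)
  then show "{m + 1, c + 1} \<in> cycle_edges n"
    by cases (use assms in \<open>auto simp: cycle_edges_def insert_commute\<close>)
qed

lemma adj_mat_dim [simp]:
  "adj_mat n E \<in> carrier_mat n n" "dim_row (adj_mat n E) = n" "dim_col (adj_mat n E) = n"
  by (auto simp: adj_mat_def)

lemma adj_mat_sym: "r < n \<Longrightarrow> c < n \<Longrightarrow> adj_mat n E $$ (r, c) = adj_mat n E $$ (c, r)"
  by (simp add: adj_mat_def insert_commute)

text \<open>The codomain is generic because the spectral radius needs complex values and the powers
  of the matrix need real ones.\<close>

lemma sum_adj_mat_cycle:
  fixes g :: "nat \<Rightarrow> 'a :: real_algebra_1"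
  assumes "2 < n" "c < n"
  shows "(\<Sum>m = 0..<n. g m * of_real (adj_mat n (cycle_edges n) $$ (m, c)))
    = g (cyc_prev n c) + g (cyc_next n c)"
proof -
  have "(\<Sum>m = 0..<n. g m * of_real (adj_mat n (cycle_edges n) $$ (m, c)))
    = (\<Sum>m = 0..<n. if m \<in> {cyc_prev n c, cyc_next n c} then g m else 0)"
    by (rule sum.cong)
      (use assms mem_cycle_edges_iff[of _ n c] in \<open>auto simp: adj_mat_def\<close>)
  also have "\<dots> = (\<Sum>m \<in> {0..<n} \<inter> {cyc_prev n c, cyc_next n c}. g m)"
    by (simp add: sum.inter_restrict)
  also have "{0..<n} \<inter> {cyc_prev n c, cyc_next n c} = {cyc_prev n c, cyc_next n c}"
    using assms cyc_prev_less cyc_next_less by auto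
  finally show ?thesis
    using cyc_prev_neq_next[OF assms(1)] by simp
qed

lemma cycle_spectral_radius_ge:
  assumes "2 < n"
  shows "2 \<le> graph_spectral_radius n (cycle_edges n)"
proof -
  let ?A = "map_mat complex_of_real (adj_mat n (cycle_edges n))"
  let ?v = "vec n (\<lambda>_. 1 :: complex)"
  have A: "?A \<in> carrier_mat n n"
    by simp
  have "?A *\<^sub>v ?v = 2 \<cdot>\<^sub>v ?v"
  proof (rule eq_vecI)
    fix c assume "c < dim_vec (2 \<cdot>\<^sub>v ?v)"
    then have c: "c < n" by simp
    \<comment> \<open>By symmetry of the matrix the row sum becomes a column sum, the form evaluated
      by \<open>sum_adj_mat_cycle\<close>.\<close>
    have "(?A *\<^sub>v ?v) $ c
      = (\<Sum>m = 0..<n. 1 * complex_of_real (adj_mat n (cycle_edges n) $$ (m, c)))"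
      using c by (auto simp: scalar_prod_def adj_mat_sym[of c] intro!: sum.cong)
    then show "(?A *\<^sub>v ?v) $ c = (2 \<cdot>\<^sub>v ?v) $ c"
      using sum_adj_mat_cycle[OF assms c, of "\<lambda>_. 1 :: complex"] c by simp
  qed simp
  moreover have "?v $ 0 \<noteq> 0\<^sub>v n $ 0"
    using assms by simp
  then have "?v \<noteq> 0\<^sub>v n"
    by metis
  ultimately have "eigenvalue ?A 2"
    unfolding eigenvalue_def eigenvector_def by (intro exI[of _ ?v]) simp
  then have "norm (2 :: complex) \<in> norm ` spectrum ?A"
    unfolding spectrum_def by blast
  from spectral_radius_mem_max(2)[OF A _ this] show ?thesis
    using assms by (simp add: graph_spectral_radius_def)
qed

section \<open>Uniqueness and convergence for the linear system\<close>

text \<open>Maximum principle: at a vertex where \<open>\<bar>x b\<bar>\<close> attains its maximum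
  \<open>?M\<close>, the equation gives \<open>?M \<le> 2 * \<alpha> * ?M\<close> with
  \<open>2 * \<alpha> < 1\<close>.\<close>

lemma cycle_harmonic_eq_0:
  fixes x :: "nat \<Rightarrow> real"
  assumes "0 \<le> \<alpha>" "\<alpha> < 1 / 2" "c < n"
    and eq: "\<And>c. c < n \<Longrightarrow> x c = \<alpha> * (x (cyc_prev n c) + x (cyc_next n c))"
  shows "x c = 0"
proof -
  let ?M = "Max ((\<lambda>c. \<bar>x c\<bar>) ` {..<n})"
  have le: "\<bar>x b\<bar> \<le> ?M" if "b < n" for b
    using that by (intro Max_ge) auto
  have "?M \<in> (\<lambda>c. \<bar>x c\<bar>) ` {..<n}"
    using assms(3) by (intro Max_in) auto
  then obtain b where b: "b < n" "?M = \<bar>x b\<bar>"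
    by auto
  have "\<bar>x b\<bar> = \<alpha> * \<bar>x (cyc_prev n b) + x (cyc_next n b)\<bar>"
    by (subst eq[OF b(1)]) (use assms(1) in \<open>simp add: abs_mult\<close>)
  also have "\<dots> \<le> \<alpha> * (2 * ?M)"
    using le[OF cyc_prev_less[OF b(1)]] le[OF cyc_next_less[OF b(1)]] assms(1)
    by (intro mult_left_mono) auto
  finally have "(1 - 2 * \<alpha>) * ?M \<le> 0"
    using b(2) by (simp add: algebra_simps)
  then have "?M \<le> 0"
    using assms(2) by (simp add: mult_le_0_iff)
  then show ?thesis
    using le[OF assms(3)] by simp
qed

text \<open>Two neighbours and one factor \<alpha> multiply the bound by \<open>2 * \<alpha>\<close>
  per step, so a geometric series dominates.\<close>

lemma cycle_walk_series:
  fixes a :: "nat \<Rightarrow> nat \<Rightarrow> real"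
  assumes "0 \<le> \<alpha>" "\<alpha> < 1 / 2" "c < n"
    and a0: "\<And>c. c < n \<Longrightarrow> \<bar>a 0 c\<bar> \<le> 1"
    and aS: "\<And>t c. c < n \<Longrightarrow> a (Suc t) c = \<alpha> * (a t (cyc_prev n c) + a t (cyc_next n c))"
  shows "summable (\<lambda>t. a t c)"
    and "(\<Sum>t. a (Suc t) c) = \<alpha> * ((\<Sum>t. a t (cyc_prev n c)) + (\<Sum>t. a t (cyc_next n c)))"
proof -
  have bound: "\<bar>a t c\<bar> \<le> (2 * \<alpha>) ^ t" if "c < n" for t c
    using that
  proof (induction t arbitrary: c)
    case (Suc t)
    have "\<bar>a (Suc t) c\<bar> = \<alpha> * \<bar>a t (cyc_prev n c) + a t (cyc_next n c)\<bar>"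
      using assms(1) by (simp add: aS[OF Suc.prems] abs_mult)
    also have "\<dots> \<le> \<alpha> * (2 * (2 * \<alpha>) ^ t)"
      using Suc.IH[OF cyc_prev_less[OF Suc.prems]] Suc.IH[OF cyc_next_less[OF Suc.prems]] assms(1)
      by (intro mult_left_mono) auto
    finally show ?case by simp
  qed (use a0 in simp)
  have "summable (\<lambda>t. (2 * \<alpha>) ^ t)"
    by (rule summable_geometric) (use assms(1,2) in simp)
  then have summ: "summable (\<lambda>t. a t c)" if "c < n" for c
    by (rule summable_comparison_test'[where N = 0]) (simp only: real_norm_def bound[OF that])
  show "summable (\<lambda>t. a t c)"
    by (rule summ[OF assms(3)])
  have "summable (\<lambda>t. a t (cyc_prev n c))" "summable (\<lambda>t. a t (cyc_next n c))"
    using assms(3) summ cyc_prev_less cyc_next_less by blast+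
  then show "(\<Sum>t. a (Suc t) c)
    = \<alpha> * ((\<Sum>t. a t (cyc_prev n c)) + (\<Sum>t. a t (cyc_next n c)))"
    by (simp add: aS[OF assms(3)] suminf_mult suminf_add summable_add)
qed

section \<open>The polynomials \<open>d\<close>, rescaled Chebyshev polynomials of the second
  kind\<close>

text \<open>The added binomials vanish since \<open>i - m < m\<close>; a range without halving makes
  index shifts free of parity cases.\<close>

lemma d_eq_sum_atMost: "d i \<alpha> = (\<Sum>m\<le>i. (-1) ^ m * real ((i - m) choose m) * \<alpha> ^ (2 * m))"
  unfolding d_def
  by (rule sum.mono_neutral_left) (auto simp: binomial_eq_0)

lemma d_0 [simp]: "d 0 \<alpha> = 1" and d_1 [simp]: "d (Suc 0) \<alpha> = 1"
  by (simp_all add: d_def)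

lemma d_rec: "d (i + 2) \<alpha> = d (i + 1) \<alpha> - \<alpha>\<^sup>2 * d i \<alpha>"
proof -
  have "d (i + 2) \<alpha>
    = 1 + (\<Sum>m\<le>i. (-1) ^ Suc m * real ((Suc i - m) choose Suc m) * \<alpha> ^ (2 * Suc m))"
    by (simp add: d_eq_sum_atMost sum.atMost_Suc_shift[of _ "Suc i"] del: sum.atMost_Suc)
  \<comment> \<open>Pascal's rule splits \<open>(Suc i - m) choose Suc m\<close>; the part with
    \<open>choose m\<close> carries the extra factor \<open>-(\<alpha>\<^sup>2)\<close>.\<close>
  also have "\<dots> = 1 + (\<Sum>m\<le>i. (-1) ^ Suc m * real ((i - m) choose Suc m) * \<alpha> ^ (2 * Suc m)
      - \<alpha>\<^sup>2 * ((-1) ^ m * real ((i - m) choose m) * \<alpha> ^ (2 * m)))"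
    by (intro arg_cong[where f = "(+) 1"] sum.cong refl)
      (auto simp: Suc_diff_le algebra_simps power2_eq_square)
  also have "\<dots> = d (i + 1) \<alpha> - \<alpha>\<^sup>2 * d i \<alpha>"
    by (simp add: d_eq_sum_atMost sum.atMost_Suc_shift sum_subtractf sum_distrib_left
        del: sum.atMost_Suc)
  finally show ?thesis .
qed

lemma d_pos:
  assumes "0 \<le> \<alpha>" "\<alpha> < 1 / 2"
  shows "0 < d i \<alpha>"
proof -
  have sq: "\<alpha>\<^sup>2 \<le> 1 / 4"
    using power_mono[of \<alpha> "1 / 2" 2] assms by (simp add: power2_eq_square)
  \<comment> \<open>Positivity alone is not inductive. The ratio bound propagates: subtracting at
    most \<open>1 / 4 * (2 * d (Suc i) \<alpha>)\<close> leaves at least half of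
    \<open>d (Suc i) \<alpha>\<close>.\<close>
  have "0 < d i \<alpha> \<and> d i \<alpha> \<le> 2 * d (Suc i) \<alpha>"
  proof (induction i)
    case (Suc i)
    have "\<alpha>\<^sup>2 * d i \<alpha> \<le> 1 / 4 * (2 * d (Suc i) \<alpha>)"
      using Suc sq by (intro mult_mono) auto
    with Suc d_rec[of i \<alpha>] show ?case by auto
  qed simp
  then show ?thesis ..
qed

section \<open>The closed form as a solution of the system\<close>

text \<open>Shifted by one to accommodate the convention \<open>d\<^sub>-\<^sub>1 = 0\<close>, under which the recurrence
  still holds.\<close>

definition d_shift :: "real \<Rightarrow> nat \<Rightarrow> real" where
  "d_shift \<alpha> i = (if i = 0 then 0 else d (i - 1) \<alpha>)"

lemma d_shift_rec: "d_shift \<alpha> (Suc (Suc i)) = d_shift \<alpha> (Suc i) - \<alpha>\<^sup>2 * d_shift \<alpha> i"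
  using d_rec[of "i - 1" \<alpha>] by (cases i) (simp_all add: d_shift_def)

text \<open>\<open>d_shift\<close> gives the right values at the ends \<open>m = 0\<close> and
  \<open>m = n\<close>, where truncated subtraction would turn the index -1 into 0.\<close>

definition cycle_num :: "nat \<Rightarrow> real \<Rightarrow> nat \<Rightarrow> real" where
  "cycle_num n \<alpha> m = \<alpha> ^ m * d_shift \<alpha> (n - m) + \<alpha> ^ (n - m) * d_shift \<alpha> m"

definition cycle_den :: "nat \<Rightarrow> real \<Rightarrow> real" where
  "cycle_den n \<alpha> = d (n - 1) \<alpha> - 2 * \<alpha> ^ n - 2 * \<alpha>\<^sup>2 * d (n - 2) \<alpha>"

text \<open>The summands trade places, so the direction in which distance is measured is
  irrelevant.\<close>

lemma cycle_num_sym: "m \<le> n \<Longrightarrow> cycle_num n \<alpha> (n - m) = cycle_num n \<alpha> m"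
  by (simp add: cycle_num_def)

text \<open>Each summand satisfies the equation by itself: its powers of \<alpha> at
  \<open>m - 1\<close> and \<open>m + 1\<close> differ by the factor \<open>\<alpha>\<^sup>2\<close>
  of \<open>d_shift_rec\<close>.\<close>

lemma cycle_num_step:
  assumes "0 < m" "m < n"
  shows "cycle_num n \<alpha> m = \<alpha> * (cycle_num n \<alpha> (m - 1) + cycle_num n \<alpha> (m + 1))"
proof -
  obtain p where p: "m = Suc p"
    using assms(1) by (cases m) auto
  obtain q where q: "n = Suc (Suc (p + q))"
    using less_imp_Suc_add[OF assms(2)] p by auto
  have "n - m = Suc q" "n - (m - 1) = Suc (Suc q)" "n - (m + 1) = q"
    by (auto simp: p q)
  then show ?thesis
    by (simp add: cycle_num_def p d_shift_rec algebra_simps power2_eq_square)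
qed

text \<open>This is where the denominator comes from: it is the defect of the equation at the
  source, whose neighbours both contribute the value at 1.\<close>

lemma cycle_num_0:
  assumes "2 \<le> n"
  shows "cycle_num n \<alpha> 0 = cycle_den n \<alpha> + 2 * \<alpha> * cycle_num n \<alpha> 1"
proof -
  obtain q where "n = Suc (Suc q)"
    using assms by (metis add_2_eq_Suc le_Suc_ex)
  then show ?thesis
    by (simp add: cycle_num_def cycle_den_def d_shift_def algebra_simps power2_eq_square)
qed

text \<open>Counts forward steps from \<open>r\<close> to \<open>c\<close>. Unlike the shortest
  distance, it changes by one per step everywhere except across \<open>r\<close>.\<close>

definition cyc_dist :: "nat \<Rightarrow> nat \<Rightarrow> nat \<Rightarrow> nat" where
  "cyc_dist n r c = (if r \<le> c then c - r else n + c - r)"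

lemma cycle_num_system:
  fixes \<alpha> :: real
  assumes "2 \<le> n" "r < n" "c < n"
  defines "F \<equiv> \<lambda>c. cycle_num n \<alpha> (cyc_dist n r c)"
  shows "F c = (if c = r then cycle_den n \<alpha> else 0) + \<alpha> * (F (cyc_prev n c) + F (cyc_next n c))"
proof -
  let ?m = "cyc_dist n r c"
  have m: "?m < n" "?m = 0 \<longleftrightarrow> c = r"
    using assms by (auto simp: cyc_dist_def)
  \<comment> \<open>Stepping forward onto \<open>r\<close> resets the distance to 0 instead of
    \<open>n\<close>; symmetry equates the two values.\<close>
  have "F (cyc_next n c) = cycle_num n \<alpha> (?m + 1)"
  proof (cases "?m + 1 = n")
    case True
    then have "cyc_dist n r (cyc_next n c) = 0"
      using assms by (auto simp: cyc_dist_def cyc_next_def split: if_splits)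
    with True show ?thesis
      using cycle_num_sym[of 0 n \<alpha>] by (simp add: F_def)
  next
    case False
    then have "cyc_dist n r (cyc_next n c) = ?m + 1"
      using assms by (auto simp: cyc_dist_def cyc_next_def split: if_splits)
    then show ?thesis
      by (simp add: F_def)
  qed
  \<comment> \<open>The predecessor of \<open>r\<close> is at distance \<open>n - 1\<close>, where
    the value is that at 1 by symmetry.\<close>
  moreover have "F (cyc_prev n c) = cycle_num n \<alpha> (if c = r then 1 else ?m - 1)"
  proof (cases "c = r")
    case True
    then have "cyc_dist n r (cyc_prev n c) = n - 1"
      using assms by (auto simp: cyc_dist_def cyc_prev_def)
    with True show ?thesis
      using cycle_num_sym[of 1 n \<alpha>] assms by (simp add: F_def)
  next
    case False
    then have "cyc_dist n r (cyc_prev n c) = ?m - 1"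
      using assms by (auto simp: cyc_dist_def cyc_prev_def split: if_splits)
    with False show ?thesis
      by (simp add: F_def)
  qed
  ultimately show ?thesis
    using cycle_num_step[of ?m n \<alpha>] cycle_num_0[OF assms(1), of \<alpha>] m
    by (cases "c = r") (simp_all add: F_def)
qed

section \<open>Comparison with the Katz series\<close>

lemma katz_cycle:
  assumes "2 < n" "0 \<le> \<alpha>" "\<alpha> < 1 / 2" "r < n" "c < n"
  shows "katz_matrix n (cycle_edges n) \<alpha> $$ (r, c)
    = cycle_num n \<alpha> (cyc_dist n r c) / cycle_den n \<alpha> - (if r = c then 1 else 0)"
proof -
  let ?A = "adj_mat n (cycle_edges n)"
  define a where "a t c = \<alpha> ^ t * (?A ^\<^sub>m t) $$ (r, c)" for t c
  define S where "S c = (\<Sum>t. a t c)" for c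
  let ?F = "\<lambda>c. cycle_num n \<alpha> (cyc_dist n r c)"
  let ?D = "cycle_den n \<alpha>"
  have dims: "dim_row (?A ^\<^sub>m t) = n" "dim_col (?A ^\<^sub>m t) = n" for t
    by (cases t; simp)+
  have a0: "a 0 b = (if b = r then 1 else 0)" if "b < n" for b
    using that assms by (simp add: a_def)
  have aS: "a (Suc t) b = \<alpha> * (a t (cyc_prev n b) + a t (cyc_next n b))" if "b < n" for t b
  proof -
    have "(?A ^\<^sub>m Suc t) $$ (r, b) = (\<Sum>m = 0..<n. (?A ^\<^sub>m t) $$ (r, m) * ?A $$ (m, b))"
      using that assms by (simp add: scalar_prod_def dims)
    also have "\<dots> = (?A ^\<^sub>m t) $$ (r, cyc_prev n b) + (?A ^\<^sub>m t) $$ (r, cyc_next n b)"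
      using sum_adj_mat_cycle[OF assms(1) that, of "\<lambda>m. (?A ^\<^sub>m t) $$ (r, m)"] by simp
    finally show ?thesis
      by (simp add: a_def algebra_simps)
  qed
  have bound0: "\<bar>a 0 b\<bar> \<le> 1" if "b < n" for b
    using a0[OF that] by simp
  note series = cycle_walk_series[where a = a, OF assms(2,3) _ bound0 aS]
  \<comment> \<open>The Katz series omits \<open>t = 0\<close>, the identity matrix; this is the
    source of the Kronecker delta.\<close>
  have tail: "(\<Sum>t. a (Suc t) b) = S b - (if b = r then 1 else 0)" if "b < n" for b
    using suminf_split_head[OF series(1)[OF that]] a0[OF that] by (simp add: S_def)
  have S_eq: "S b = (if b = r then 1 else 0) + \<alpha> * (S (cyc_prev n b) + S (cyc_next n b))"
    if "b < n" for b
    using tail[OF that] series(2)[OF that] by (simp add: S_def)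
  have F_eq: "?F b = (if b = r then ?D else 0) + \<alpha> * (?F (cyc_prev n b) + ?F (cyc_next n b))"
    if "b < n" for b
    using cycle_num_system[of n r b \<alpha>] assms that by simp
  have FS: "?F b = ?D * S b" if "b < n" for b
  proof -
    \<comment> \<open>The source terms at \<open>r\<close> cancel, leaving a homogeneous
      system.\<close>
    have "?F b - ?D * S b = 0"
    proof (rule cycle_harmonic_eq_0[where x = "\<lambda>b. ?F b - ?D * S b", OF assms(2,3) that])
      fix b assume b: "b < n"
      show "?F b - ?D * S b = \<alpha> * ((?F (cyc_prev n b) - ?D * S (cyc_prev n b))
        + (?F (cyc_next n b) - ?D * S (cyc_next n b)))"
        by (subst F_eq[OF b], subst S_eq[OF b]) (simp add: algebra_simps)
    qed
    then show ?thesis by simp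
  qed
  have "?F r = d (n - 1) \<alpha>"
    using assms by (simp add: cycle_num_def cyc_dist_def d_shift_def)
  then have "?D \<noteq> 0"
    using FS[OF assms(4)] d_pos[OF assms(2,3), of "n - 1"] by auto
  then have "S c = ?F c / ?D"
    using FS[OF assms(5)] by simp
  moreover have "katz_matrix n (cycle_edges n) \<alpha> $$ (r, c) = (\<Sum>t. a (Suc t) c)"
    using assms by (simp add: katz_matrix_def a_def dims del: pow_mat.simps power_Suc)
  ultimately show ?thesis
    using tail[OF assms(5)] by auto
qed

theorem theorem11:
  fixes n i j k :: nat and \<alpha> :: real
  assumes "n > 4"
    and "1 \<le> i" and "i < j" and "j \<le> n"
    and "0 < \<alpha>" and "\<alpha> < 1 / graph_spectral_radius n (cycle_edges n)"
    and "k = min (j - i) (n - j + i)"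
  shows "katz_index n (cycle_edges n) \<alpha> i j =
    (\<alpha> ^ k * d (n - k - 1) \<alpha> + \<alpha> ^ (n - k) * d (k - 1) \<alpha>) /
      (d (n - 1) \<alpha> - 2 * \<alpha> ^ n - 2 * \<alpha>\<^sup>2 * d (n - 2) \<alpha>)
    - (if i = j then 1 else 0)"
proof -
  have "2 \<le> graph_spectral_radius n (cycle_edges n)"
    using assms by (intro cycle_spectral_radius_ge) simp
  then have "1 / graph_spectral_radius n (cycle_edges n) \<le> 1 / 2"
    by (intro divide_left_mono) auto
  then have "\<alpha> < 1 / 2"
    using assms(6) by simp
  then have "katz_index n (cycle_edges n) \<alpha> i j
    = cycle_num n \<alpha> (j - i) / cycle_den n \<alpha> - (if i = j then 1 else 0)"
    using katz_cycle[of n \<alpha> "i - 1" "j - 1"] assms(1-5)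
    by (auto simp: katz_index_def cyc_dist_def)
  \<comment> \<open>The shortest distance is the forward one or its complement in \<open>n\<close>,
    with equal numerators.\<close>
  moreover have "k = j - i \<or> k = n - (j - i)"
    using assms by auto
  then have "cycle_num n \<alpha> (j - i) = cycle_num n \<alpha> k"
    using assms(4) cycle_num_sym[of "j - i" n \<alpha>] by auto
  \<comment> \<open>Away from both ends \<open>d_shift\<close> unfolds to \<open>d\<close>.\<close>
  moreover have "0 < k" "k < n"
    using assms by auto
  ultimately show ?thesis
    by (simp add: cycle_num_def cycle_den_def d_shift_def)
qed

end
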